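(* Let $q$ be a nonzero complex number that is not a root of unity. For all complex numbers $z,w$ and every nonnegative integer $n$, $$(z+iw)_q^n=\frac{1}{[2]_q^n}\sum_{k=0}^n {n \brack k}_q\, i^k\, q^{\frac{k(k-1)}{2}}\, H_{n-k}(z;q)\, H_k\!\left(qw;\tfrac1q\right).$$
   Context: $[n]_q=\frac{q^n-1}{q-1}$, $[n]_q!=[1]_q[2]_q\cdots[n]_q$ (with $[0]_q!=1$), and ${n \brack k}_q=\frac{[n]_q!}{[k]_q!\,[n-k]_q!}$. The $q$-binomial is $(z+iw)_q^n=(z+iw)(z+iqw)(z+iq^2w)\cdots(z+iq^{n-1}w)$, with $(z+iw)_q^0=1$. Jackson's $q$-exponential is the (formal) power series $e_q(x)=\sum_{n=0}^\infty \frac{x^n}{[n]_q!}$. The $q$-Hermite polynomials $H_n(x;q)$ are defined by the generating function (an identity of formal power series in $t$) $$e_q(-t^2)\,e_q([2]_q\,t\,x)=\sum_{n=0}^\infty H_n(x;q)\frac{t^n}{[n]_q!}.$$ $H_n(x;\frac1q)$ is the polynomial obtained from the same definition with $q$ replaced by $1/q$ everywhere. Here $i$ is the imaginary unit. *)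

theory Defs
  imports "HOL-Computational_Algebra.Computational_Algebra" Complex_Main
begin

definition q_int :: "complex \<Rightarrow> nat \<Rightarrow> complex" where
  "q_int q n = (q ^ n - 1) / (q - 1)"

definition q_fact :: "complex \<Rightarrow> nat \<Rightarrow> complex" where
  "q_fact q n = (\<Prod>k=1..n. q_int q k)"

definition q_choose :: "complex \<Rightarrow> nat \<Rightarrow> nat \<Rightarrow> complex" where
  "q_choose q n k = q_fact q n / (q_fact q k * q_fact q (n - k))"

definition q_binomial :: "complex \<Rightarrow> complex \<Rightarrow> complex \<Rightarrow> nat \<Rightarrow> complex" where
  "q_binomial q z w n = (\<Prod>j<n. z + \<i> * q ^ j * w)"

text \<open>
  The generating function of the \<open>q\<close>-Hermite polynomials is a formal power series in \<open>t\<close>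
  (\<^const>\<open>fps_X\<close>) whose coefficients are polynomials in \<open>x\<close> (the variable of
  \<^typ>\<open>complex poly\<close>), so Jackson's exponential is taken with coefficients in
  \<^typ>\<open>complex poly\<close>, and substitution is \<^const>\<open>fps_compose\<close>.
\<close>

definition q_exp :: "complex \<Rightarrow> complex poly fps" where
  "q_exp q = Abs_fps (\<lambda>n. [:1 / q_fact q n:])"

definition q_hermite_gf :: "complex \<Rightarrow> complex poly fps" where
  "q_hermite_gf q =
     fps_compose (q_exp q) (- (fps_X ^ 2)) *
     fps_compose (q_exp q) (fps_const [:0, q_int q 2:] * fps_X)"

definition q_hermite :: "complex \<Rightarrow> nat \<Rightarrow> complex poly" where
  "q_hermite q n = smult (q_fact q n) (fps_nth (q_hermite_gf q) n)"

lemma q_fact_nonzero: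
  assumes "\<And>m. m > 0 \<Longrightarrow> q ^ m \<noteq> 1"
  shows "q_fact q n \<noteq> 0"
  using assms assms[of 1] by (auto simp: q_fact_def q_int_def)

lemma q_hermite_generating_function:
  assumes "\<And>m. m > 0 \<Longrightarrow> q ^ m \<noteq> 1"
  shows "q_hermite_gf q = Abs_fps (\<lambda>n. smult (1 / q_fact q n) (q_hermite q n))"
  using q_fact_nonzero[OF assms] by (intro fps_ext) (simp add: q_hermite_def)

end

theory Submission
  imports Defs
begin

text \<open>
  The identity is the coefficient form of a product of generating functions. Replacing \<open>q\<close> by
  \<open>1 / q\<close> turns \<open>[n]\<^sub>q!\<close> into \<open>q\<close> to the power \<open>- n (n - 1) / 2\<close> times \<open>[n]\<^sub>q!\<close>
  (\<open>q_fact_inverse\<close>), so the factor \<open>i\<^sup>k q\<^bsup>k (k - 1) / 2\<^esup> / [k]\<^sub>q!\<close> in the sum is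
  \<open>i\<^sup>k / [k]!\<close> for the base \<open>1 / q\<close>. Hence the sum, divided by \<open>[n]\<^sub>q!\<close>, is the coefficient of
  \<open>t\<^sup>n\<close> in the Hermite generating function for \<open>q\<close> at \<open>t\<close> and \<open>z\<close> times the one for \<open>1 / q\<close> at
  \<open>i t\<close> and \<open>q w\<close>. Write \<open>e\<close> and \<open>E\<close> for the \<open>q\<close>-exponentials with bases \<open>q\<close> and \<open>1 / q\<close>. As
  \<open>q [2]\<close> for the base \<open>1 / q\<close> equals \<open>[2]\<^sub>q\<close>, that product is
  \<open>e(- t\<^sup>2) E(t\<^sup>2) e([2]\<^sub>q z t) E([2]\<^sub>q i w t)\<close>.

  Both halves are governed by \<open>q_exp_product\<close>: the coefficients of \<open>e(a t) E(b t)\<close> are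
  \<open>(a + b) (a + q b) \<dots> (a + q\<^bsup>n - 1\<^esup> b) / [n]\<^sub>q!\<close>. For \<open>a = - 1\<close> and \<open>b = 1\<close> the first factor
  vanishes, which gives \<open>e(- t\<^sup>2) E(t\<^sup>2) = 1\<close>; for \<open>a = [2]\<^sub>q z\<close> and \<open>b = [2]\<^sub>q i w\<close> it gives
  \<open>[2]\<^sub>q\<^sup>n\<close> times the \<open>q\<close>-binomial.
\<close>

section \<open>The \<open>q\<close>-factorial and inversion of the base\<close>

lemma q_fact_Suc: "q_fact q (Suc n) = q_int q (Suc n) * q_fact q n"
  by (simp add: q_fact_def)

lemma q_int_inverse:
  assumes "q \<noteq> 0" "q \<noteq> 1"
  shows "q_int (1 / q) (Suc n) = q_int q (Suc n) / q ^ n"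
  using assms by (simp add: q_int_def field_simps)

lemma triangular_Suc: "Suc n * n div 2 = n * (n - 1) div 2 + (n :: nat)"
proof (cases n)
  case (Suc m)
  have "Suc n * n = n * (n - 1) + 2 * n"
    by (simp add: Suc)
  thus ?thesis by simp
qed simp

lemma q_fact_inverse:
  assumes "q \<noteq> 0" "q \<noteq> 1"
  shows "q_fact (1 / q) n = q_fact q n / q ^ (n * (n - 1) div 2)"
proof (induction n)
  case (Suc n)
  show ?case
    using triangular_Suc[of n] assms
    by (simp add: q_fact_Suc q_int_inverse Suc.IH power_add del: mult_Suc)
qed (simp add: q_fact_def)

section \<open>Jackson's exponential with scalar coefficients\<close>

definition q_exp_scalar :: "complex \<Rightarrow> complex fps" where
  "q_exp_scalar q = Abs_fps (\<lambda>n. 1 / q_fact q n)"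

lemma q_exp_scalar_nth [simp]: "fps_nth (q_exp_scalar q) n = 1 / q_fact q n"
  by (simp add: q_exp_scalar_def)

text \<open>
  Since \<open>a\<^sup>n (q\<^sup>n - 1) / [n]\<^sub>q! = (q - 1) a \<cdot> a\<^bsup>n - 1\<^esup> / [n - 1]\<^sub>q!\<close>, multiplying the variable of
  the \<open>q\<close>-exponential by \<open>q\<close> costs only a linear factor.
\<close>
lemma q_exp_scalar_q_shift:
  assumes "\<And>m::nat. m > 0 \<Longrightarrow> q ^ m \<noteq> 1"
  shows "q_exp_scalar q oo (fps_const (q * a) * fps_X) =
    (1 + fps_const ((q - 1) * a) * fps_X) * (q_exp_scalar q oo (fps_const a * fps_X))"
proof (rule fps_ext)
  fix n
  show "fps_nth (q_exp_scalar q oo (fps_const (q * a) * fps_X)) n =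
    fps_nth ((1 + fps_const ((q - 1) * a) * fps_X) *
      (q_exp_scalar q oo (fps_const a * fps_X))) n"
  proof (cases n)
    case 0
    thus ?thesis by (simp add: q_fact_def)
  next
    case (Suc m)
    have "q \<noteq> 1" "q ^ Suc m \<noteq> 1" "q_fact q m \<noteq> 0"
      using assms[of 1] assms[of "Suc m"] q_fact_nonzero[OF assms] by auto
    thus ?thesis
      by (simp add: Suc distrib_right mult.assoc fps_compose_linear q_fact_Suc q_int_def
            power_mult_distrib divide_simps del: power_Suc)
         (simp add: algebra_simps)
  qed
qed

text \<open>
  The functional equations of both exponentials show that \<open>F(t) = e(a t) E(b t)\<close> satisfies
  \<open>(1 + (1 - q) b t) F(q t) = (1 + (q - 1) a t) F(t)\<close>. Comparing coefficients yields the
  first-order recurrence \<open>[n + 1]\<^sub>q F\<^sub>n\<^sub>+\<^sub>1 = (a + q\<^sup>n b) F\<^sub>n\<close>, so no summation over products of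
  coefficients is needed.
\<close>
lemma q_exp_product:
  assumes "q \<noteq> 0" and "\<And>m::nat. m > 0 \<Longrightarrow> q ^ m \<noteq> 1"
  shows "fps_nth ((q_exp_scalar q oo (fps_const a * fps_X)) *
      (q_exp_scalar (1 / q) oo (fps_const b * fps_X))) n =
    (\<Prod>j<n. a + q ^ j * b) / q_fact q n"
proof -
  define A where "A c = q_exp_scalar q oo (fps_const c * fps_X)" for c
  define B where "B c = q_exp_scalar (1 / q) oo (fps_const c * fps_X)" for c
  define F where "F = A a * B b"
  have inv_not_root: "(1 / q) ^ m \<noteq> 1" if "m > 0" for m
    using assms(2)[OF that] assms(1) by (simp add: power_divide)
  have shift_A: "A (q * a) = (1 + fps_const ((q - 1) * a) * fps_X) * A a"
    unfolding A_def by (rule q_exp_scalar_q_shift) (use assms in auto)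
  \<comment> \<open>The shift of base \<open>1 / q\<close>, taken at \<open>q b\<close>, undoes multiplication of the variable by \<open>q\<close>.\<close>
  have "B (1 / q * (q * b)) = (1 + fps_const ((1 / q - 1) * (q * b)) * fps_X) * B (q * b)"
    unfolding B_def by (rule q_exp_scalar_q_shift) (use inv_not_root in auto)
  hence shift_B: "(1 + fps_const ((1 - q) * b) * fps_X) * B (q * b) = B b"
    using assms(1) by (simp add: field_simps)
  define G where "G = A (q * a) * B (q * b)"
  have dilate: "fps_nth G m = q ^ m * fps_nth F m" for m
    unfolding G_def F_def A_def B_def
    by (simp add: fps_mult_nth fps_compose_linear sum_distrib_left power_mult_distrib)
       (auto intro!: sum.cong simp flip: power_add)
  have func: "(1 + fps_const ((1 - q) * b) * fps_X) * G =
      (1 + fps_const ((q - 1) * a) * fps_X) * F"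
    unfolding G_def F_def shift_A shift_B[symmetric] by (simp only: mult_ac)
  have rec: "q_int q (Suc m) * fps_nth F (Suc m) = (a + q ^ m * b) * fps_nth F m" for m
  proof -
    have "fps_nth ((1 + fps_const ((1 - q) * b) * fps_X) * G) (Suc m) =
        fps_nth ((1 + fps_const ((q - 1) * a) * fps_X) * F) (Suc m)"
      by (simp only: func)
    hence "(q ^ Suc m - 1) * fps_nth F (Suc m) = (q - 1) * ((a + q ^ m * b) * fps_nth F m)"
      by (simp add: distrib_right mult.assoc dilate) (simp add: algebra_simps)
    thus ?thesis
      using assms(2)[of 1] by (simp add: q_int_def field_simps)
  qed
  have "fps_nth F n = (\<Prod>j<n. a + q ^ j * b) / q_fact q n"
  proof (induction n)
    case 0
    show ?case by (simp add: F_def A_def B_def q_fact_def)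
  next
    case (Suc m)
    have "q_int q (Suc m) \<noteq> 0"
      using assms(2)[of 1] assms(2)[of "Suc m"] by (simp add: q_int_def)
    hence "fps_nth F (Suc m) = (a + q ^ m * b) * fps_nth F m / q_int q (Suc m)"
      using rec[of m] by (simp add: nonzero_eq_divide_eq mult.commute)
    thus ?case
      by (simp add: Suc.IH q_fact_Suc mult_ac)
  qed
  thus ?thesis by (simp add: F_def A_def B_def)
qed

lemma q_exp_scalar_inverse:
  assumes "q \<noteq> 0" and "\<And>m::nat. m > 0 \<Longrightarrow> q ^ m \<noteq> 1"
  shows "(q_exp_scalar q oo - (fps_X ^ 2)) * (q_exp_scalar (1 / q) oo fps_X ^ 2) = 1"
proof -
  have "(q_exp_scalar q oo (fps_const (- 1) * fps_X)) *
      (q_exp_scalar (1 / q) oo (fps_const 1 * fps_X)) = 1" (is "?P = 1")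
  proof (rule fps_ext)
    fix n
    have "(\<Prod>j<n. - 1 + q ^ j * 1) = 0" if "n > 0"
      using that by (intro prod_zero) (auto intro: bexI[of _ 0])
    hence "(\<Prod>j<n. - 1 + q ^ j * 1) / q_fact q n = fps_nth 1 n"
      by (cases "n = 0") (simp_all only: q_fact_def, simp_all)
    thus "fps_nth ?P n = fps_nth 1 n"
      by (simp only: q_exp_product[OF assms])
  qed
  hence "?P oo fps_X ^ 2 = 1" by simp
  moreover have "?P oo fps_X ^ 2 =
      (q_exp_scalar q oo - (fps_X ^ 2)) * (q_exp_scalar (1 / q) oo fps_X ^ 2)"
    by (simp add: fps_compose_mult_distrib fps_compose_uminus flip: fps_compose_assoc
        fps_const_neg)
  ultimately show ?thesis by simp
qed

section \<open>Evaluating the Hermite generating function at a point\<close>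

definition fps_eval :: "complex \<Rightarrow> complex poly fps \<Rightarrow> complex fps" where
  "fps_eval x F = Abs_fps (\<lambda>n. poly (fps_nth F n) x)"

lemma fps_eval_nth [simp]: "fps_nth (fps_eval x F) n = poly (fps_nth F n) x"
  by (simp add: fps_eval_def)

lemma fps_eval_mult: "fps_eval x (F * G) = fps_eval x F * fps_eval x G"
  by (rule fps_ext) (simp add: fps_mult_nth poly_sum)

lemma fps_eval_power: "fps_eval x (F ^ n) = fps_eval x F ^ n"
proof (induction n)
  case 0
  show ?case by (rule fps_ext) simp
qed (simp add: fps_eval_mult)

lemma fps_eval_compose: "fps_eval x (F oo G) = fps_eval x F oo fps_eval x G"
  by (rule fps_ext) (simp add: fps_compose_nth poly_sum flip: fps_eval_power)

lemma fps_eval_q_hermite_gf: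
  "fps_eval x (q_hermite_gf q) =
    (q_exp_scalar q oo - (fps_X ^ 2)) *
    (q_exp_scalar q oo (fps_const (q_int q 2 * x) * fps_X))"
proof -
  have "fps_eval x (q_exp q) = q_exp_scalar q"
    by (rule fps_ext) (simp add: q_exp_def q_exp_scalar_def)
  moreover have "fps_eval x (- (fps_X ^ 2)) = - (fps_X ^ 2)"
    by (rule fps_ext) (simp add: fps_X_power_nth)
  moreover have "fps_eval x (fps_const [:0, q_int q 2:] * fps_X) =
      fps_const (q_int q 2 * x) * fps_X"
    by (rule fps_ext) (simp add: fps_X_def)
  ultimately show ?thesis
    by (simp add: q_hermite_gf_def fps_eval_mult fps_eval_compose)
qed

lemma poly_q_hermite:
  "poly (q_hermite q n) x = q_fact q n * fps_nth (fps_eval x (q_hermite_gf q)) n"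
  by (simp add: q_hermite_def)

text \<open>
  Multiplying \<open>t\<close> by \<open>i\<close> turns \<open>- t\<^sup>2\<close> into \<open>t\<^sup>2\<close>, so that the quadratic exponential of this series
  is the reciprocal of the one in the generating function with base \<open>q\<close>.
\<close>
lemma hermite_gf_inverse_base_dilate:
  assumes "q \<noteq> 0" "q \<noteq> 1"
  shows "fps_eval (q * w) (q_hermite_gf (1 / q)) oo (fps_const \<i> * fps_X) =
    (q_exp_scalar (1 / q) oo fps_X ^ 2) *
    (q_exp_scalar (1 / q) oo (fps_const (q_int q 2 * (\<i> * w)) * fps_X))"
proof -
  have sq: "- (fps_X ^ 2) oo (fps_const \<i> * fps_X) = (fps_X ^ 2 :: complex fps)"
  proof -
    have "- (fps_X ^ 2) oo (fps_const \<i> * fps_X) = - ((fps_const \<i> * fps_X) ^ 2 :: complex fps)"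
      by (simp add: fps_compose_uminus flip: fps_compose_power)
    also have "\<dots> = fps_X ^ 2"
      by (simp add: power_mult_distrib fps_const_power flip: fps_const_neg)
    finally show ?thesis .
  qed
  have two: "q_int (1 / q) 2 * q = q_int q 2"
    using q_int_inverse[OF assms, of 1] assms(1) by (simp add: numeral_2_eq_2)
  have linear: "(q_exp_scalar (1 / q) oo (fps_const (q_int (1 / q) 2 * (q * w)) * fps_X)) oo
      (fps_const \<i> * fps_X) =
      q_exp_scalar (1 / q) oo (fps_const (q_int q 2 * (\<i> * w)) * fps_X)"
    by (rule fps_ext) (simp add: power_mult_distrib flip: two)
  have square: "(q_exp_scalar (1 / q) oo - (fps_X ^ 2)) oo (fps_const \<i> * fps_X) =
      q_exp_scalar (1 / q) oo fps_X ^ 2"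
    by (simp add: sq flip: fps_compose_assoc)
  show ?thesis
    unfolding fps_eval_q_hermite_gf linear[symmetric] square[symmetric]
    by (rule fps_compose_mult_distrib) simp
qed

section \<open>The expansion of the \<open>q\<close>-binomial\<close>

theorem mainTheorem2:
  fixes q z w :: complex and n :: nat
  assumes "q \<noteq> 0"
    and "\<And>m::nat. m > 0 \<Longrightarrow> q ^ m \<noteq> 1"
  shows "q_binomial q z w n =
    1 / q_int q 2 ^ n *
    (\<Sum>k=0..n. q_choose q n k * \<i> ^ k * q ^ (k * (k - 1) div 2) *
       poly (q_hermite q (n - k)) z * poly (q_hermite (1 / q) k) (q * w))"
proof -
  define c where "c = q_int q 2"
  define P where "P = fps_eval z (q_hermite_gf q)"
  define Q where "Q = fps_eval (q * w) (q_hermite_gf (1 / q))"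
  define Q' where "Q' = Q oo (fps_const \<i> * fps_X)"
  have q1: "q \<noteq> 1" using assms(2)[of 1] by simp
  have nz: "q_fact q k \<noteq> 0" for k by (rule q_fact_nonzero) (use assms in auto)
  have "c \<noteq> 0" using q1 assms(2)[of 2] by (simp add: c_def q_int_def)
  have Q'_nth: "fps_nth Q' k = \<i> ^ k * fps_nth Q k" for k
    by (simp add: Q'_def)
  have summand: "q_choose q n k * \<i> ^ k * q ^ (k * (k - 1) div 2) *
      poly (q_hermite q (n - k)) z * poly (q_hermite (1 / q) k) (q * w) =
      q_fact q n * (fps_nth Q' k * fps_nth P (n - k))" for k
    using nz[of k] nz[of "n - k"] assms(1)
    by (simp add: poly_q_hermite q_choose_def q_fact_inverse[OF assms(1) q1] Q'_nth
        field_simps flip: P_def Q_def)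
  have "P * Q' = (q_exp_scalar q oo - (fps_X ^ 2)) * (q_exp_scalar (1 / q) oo fps_X ^ 2) *
      ((q_exp_scalar q oo (fps_const (c * z) * fps_X)) *
       (q_exp_scalar (1 / q) oo (fps_const (c * (\<i> * w)) * fps_X)))"
    unfolding P_def Q'_def Q_def hermite_gf_inverse_base_dilate[OF assms(1) q1]
      fps_eval_q_hermite_gf[of z q] c_def
    by (simp only: mult_ac)
  also have "\<dots> = (q_exp_scalar q oo (fps_const (c * z) * fps_X)) *
       (q_exp_scalar (1 / q) oo (fps_const (c * (\<i> * w)) * fps_X))"
    by (simp add: q_exp_scalar_inverse[OF assms])
  finally have "fps_nth (P * Q') n = (\<Prod>j<n. c * z + q ^ j * (c * (\<i> * w))) / q_fact q n"
    by (simp only: q_exp_product[OF assms])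
  also have "(\<Prod>j<n. c * z + q ^ j * (c * (\<i> * w))) = (\<Prod>j<n. c * (z + \<i> * q ^ j * w))"
    by (simp add: algebra_simps)
  also have "\<dots> = c ^ n * q_binomial q z w n"
    by (simp add: q_binomial_def prod.distrib)
  finally have coeff: "q_fact q n * fps_nth (Q' * P) n = c ^ n * q_binomial q z w n"
    using nz[of n] by (simp add: mult.commute)
  show ?thesis
    unfolding summand
    using coeff \<open>c \<noteq> 0\<close> by (simp add: fps_mult_nth sum_distrib_left c_def)
qed

end
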